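(* For every integer $t \geq 4$, $R(P_{t}^{+}, P_{t}^{+}) = 2t - 1$.
   Context: For $t \geq 3$, $P_t$ denotes the path on $t$ vertices $v_1v_2\cdots v_t$, and $P_t^{+}$ denotes the graph obtained from $P_t$ by adding the edge $v_1v_3$ (so that an end vertex together with the vertex at distance $2$ from it along the path forms a triangle). For graphs $G,H$, the Ramsey number $R(G,H)$ is the minimum integer $n$ such that every coloring of the edges of $K_n$ with red and blue contains a red copy of $G$ or a blue copy of $H$. *)

theory Defs
  imports "HOL-Library.Ramsey"
begin

text \<open>A simple graph is represented by its vertex set and its set of edges, the edges being
  two-element sets of vertices. The type does not enforce this; the graphs used here satisfy it.\<close>

type_synonym 'a graph = "'a set \<times> 'a set set"

definition verts :: "'a graph \<Rightarrow> 'a set" where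
  "verts G = fst G"

definition edges :: "'a graph \<Rightarrow> 'a set set" where
  "edges G = snd G"

text \<open>The copy need not be induced.\<close>

definition contains_copy :: "'b graph \<Rightarrow> 'a graph \<Rightarrow> bool" where
  "contains_copy K G \<longleftrightarrow>
     (\<exists>\<phi>. inj_on \<phi> (verts G) \<and> \<phi> ` verts G \<subseteq> verts K \<and> (\<forall>e\<in>edges G. \<phi> ` e \<in> edges K))"

definition path_graph :: "nat \<Rightarrow> nat graph" where
  "path_graph t = ({1..t}, {{i, i + 1} | i. 1 \<le> i \<and> i < t})"

text \<open>A simple graph for \<open>t \<ge> 3\<close> only: otherwise 3 is not a vertex.\<close>

definition path_plus :: "nat \<Rightarrow> nat graph" where
  "path_plus t = (verts (path_graph t), insert {1, 3} (edges (path_graph t)))"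

definition complete_graph :: "nat \<Rightarrow> nat graph" where
  "complete_graph n = ({..<n}, nsets {..<n} 2)"

datatype colour = Red | Blue

definition colour_graph :: "nat \<Rightarrow> (nat set \<Rightarrow> colour) \<Rightarrow> colour \<Rightarrow> nat graph" where
  "colour_graph n c a =
     (verts (complete_graph n), {e \<in> edges (complete_graph n). c e = a})"

text \<open>A colouring is a total function on sets of naturals; only its values on the edges of the
  complete graph matter, so quantifying over all such functions ranges over all edge colourings.\<close>

definition ramsey_arrows :: "nat \<Rightarrow> 'a graph \<Rightarrow> 'b graph \<Rightarrow> bool" where
  "ramsey_arrows n G H \<longleftrightarrow>
     (\<forall>c. contains_copy (colour_graph n c Red) G \<or> contains_copy (colour_graph n c Blue) H)"

definition ramsey_number :: "'a graph \<Rightarrow> 'b graph \<Rightarrow> nat" where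
  "ramsey_number G H = (LEAST n. ramsey_arrows n G H)"

end

theory Submission
  imports Defs
begin

text \<open>Two cliques of order \<open>t - 1\<close> show that \<open>2 t - 2\<close> vertices do not suffice. For the upper bound
  let \<open>t \<ge> 5\<close>. On \<open>2 t - 1\<close> vertices the majority colour has enough edges for a cycle of length
  \<open>m \<ge> t\<close>, by the Erdos--Gallai theorem. If there is no monochromatic copy, then all chords
  \<open>v i, v (i + 2)\<close> have the other colour, and a vertex off the cycle is joined in the other colour
  to one of any two consecutive cycle vertices. For odd \<open>m < 2 t - 1\<close> the chords form another cycle
  of length \<open>m\<close>, and no vertex off the cycle can satisfy the condition for both cycles. For even
  \<open>m\<close> the chords form two cycles of length \<open>m div 2\<close>, which are extended by vertices off the
  cycle and linked to each other by a vertex that has neighbours on both. For \<open>m = 2 t - 1\<close> the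
  chord \<open>v 0, v 4\<close> either closes a copy or shortens the cycle to even length \<open>m - 3\<close>.\<close>

subsection \<open>Long cycles in dense graphs\<close>

definition path_on :: "('a \<Rightarrow> 'a \<Rightarrow> bool) \<Rightarrow> 'a set \<Rightarrow> 'a list \<Rightarrow> bool" where
  "path_on P V xs \<longleftrightarrow> distinct xs \<and> set xs \<subseteq> V \<and> successively P xs"

lemma path_on_take: "path_on P V xs \<Longrightarrow> path_on P V (take n xs)"
  unfolding path_on_def using set_take_subset[of n xs]
  by (auto simp: successively_conv_nth)

lemma path_on_length_le:
  assumes "finite V" "path_on P V xs"
  shows "length xs \<le> card V"
  using assms by (metis card_mono distinct_card path_on_def)

text \<open>Rotation in the sense of Posa: the chord from the first vertex to \<open>xs ! j\<close>
  replaces the edge before \<open>xs ! j\<close>, so that \<open>xs ! (j - 1)\<close> becomes the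
  first vertex.\<close>

lemma path_on_rotate:
  assumes "symp P" and p: "path_on P V xs" and j: "0 < j" "j < length xs" and e: "P (xs ! 0) (xs ! j)"
  shows "path_on P V (rev (take j xs) @ drop j xs)"
proof -
  have s: "successively P (take j xs @ drop j xs)" using p by (simp add: path_on_def)
  have "successively P (take j xs)" "successively P (drop j xs)"
    using s unfolding successively_append_iff by auto
  moreover have "successively (\<lambda>x y. P y x) (take j xs)"
    using \<open>symp P\<close> calculation(1) by (metis (mono_tags, lifting) successively_mono sympD)
  moreover have "last (rev (take j xs)) = xs ! 0" "hd (drop j xs) = xs ! j"
    using j by (cases xs; simp add: last_rev hd_drop_conv_nth)+
  ultimately have "successively P (rev (take j xs) @ drop j xs)"
    using e by (simp add: successively_append_iff)
  moreover have "distinct (take j xs @ drop j xs)" using p by (simp add: path_on_def)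
  then have "distinct (rev (take j xs) @ drop j xs)" by (simp only: distinct_append distinct_rev set_rev)
  moreover have "set (rev (take j xs) @ drop j xs) = set (take j xs @ drop j xs)" by (simp only: set_append set_rev)
  ultimately show ?thesis using p by (simp add: path_on_def)
qed

text \<open>Otherwise a longest path could be extended or closed to a long cycle.\<close>

lemma neighbours_of_longest_path_start:
  assumes "symp P"
    and no_cycle: "\<And>ys. \<lbrakk>path_on P V ys; k \<le> length ys\<rbrakk> \<Longrightarrow> \<not> P (last ys) (hd ys)"
    and p: "path_on P V xs" "xs \<noteq> []"
    and longest: "\<And>ys. path_on P V ys \<Longrightarrow> length ys \<le> length xs"
    and y: "y \<in> V" "P (hd xs) y"
  shows "y \<in> set (take (k - 1) xs)"
proof -
  have "y \<in> set xs"
  proof (rule ccontr)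
    assume "y \<notin> set xs"
    then have "path_on P V (y # xs)"
      using p y \<open>symp P\<close> by (auto simp: path_on_def successively_Cons dest: sympD)
    then show False using longest by fastforce
  qed
  then obtain j where j: "j < length xs" "y = xs ! j" by (metis in_set_conv_nth)
  have "j < k - 1"
  proof (rule ccontr)
    assume "\<not> j < k - 1"
    then have "k \<le> length (take (Suc j) xs)" using j by simp
    moreover have "P (last (take (Suc j) xs)) (hd (take (Suc j) xs))"
      using j y p \<open>symp P\<close> by (simp add: last_conv_nth sympD)
    ultimately show False using no_cycle path_on_take[OF p(1)] by blast
  qed
  then show ?thesis using j by (auto simp: in_set_conv_nth intro!: exI[of _ j])
qed

lemma card_pairs_le:
  assumes "finite T" "finite N" and "\<And>x. x \<in> T \<Longrightarrow> card {y\<in>N. P x y} \<le> d"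
  shows "card {(x, y). x \<in> T \<and> y \<in> N \<and> P x y} \<le> card T * d"
proof -
  have "{(x, y). x \<in> T \<and> y \<in> N \<and> P x y} = Sigma T (\<lambda>x. {y\<in>N. P x y})" by auto
  then show ?thesis using sum_bounded_above[of T "\<lambda>x. card {y\<in>N. P x y}" d] assms by simp
qed

text \<open>The Erdos--Gallai bound for cycles, with edges counted as ordered pairs. A longest path whose
  first vertex has the largest possible degree \<open>d\<close> yields, by rotation, a set \<open>T\<close> of \<open>d\<close> vertices of
  degree at most \<open>d\<close> with all their neighbours among the first \<open>k - 1\<close> vertices of the path; hence
  removing \<open>T\<close> destroys at most \<open>d\<^sup>2 + d (k - 1 - d)\<close> ordered pairs.\<close>

lemma erdos_gallai_cycle:
  assumes "finite V" "V \<noteq> {}" "symp P" "irreflp P"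
    and no_cycle: "\<And>xs. \<lbrakk>path_on P V xs; k \<le> length xs\<rbrakk> \<Longrightarrow> \<not> P (last xs) (hd xs)"
  shows "card {(x, y). x \<in> V \<and> y \<in> V \<and> P x y} \<le> (k - 1) * (card V - 1)"
  using assms(1,2) no_cycle
proof (induction V rule: finite_psubset_induct)
  case (psubset V)
  note [simp] = \<open>finite V\<close>
  define deg where "deg x = card {y\<in>V. P x y}" for x
  have deg: "deg x \<le> card V" for x by (auto simp: deg_def intro: card_mono)
  obtain v where v: "v \<in> V" using psubset.prems by blast
  \<comment> \<open>Since degrees are at most \<open>card V\<close>, maximising \<open>f\<close>
    maximises the length first and the degree of the first vertex second.\<close>
  define f where "f xs = length xs * (card V + 1) + deg (hd xs)" for xs
  have "f ys < card V * (card V + 1) + card V + 1" if "path_on P V ys" for ys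
    unfolding f_def using path_on_length_le[OF \<open>finite V\<close> that] deg[of "hd ys"]
    by (meson add_le_mono le_imp_less_Suc mult_le_mono1 less_add_one le_less_trans)
  moreover have "path_on P V [v]" using v by (simp add: path_on_def)
  ultimately obtain xs where p: "path_on P V xs" and f: "\<And>ys. path_on P V ys \<Longrightarrow> f ys \<le> f xs"
    using ex_has_greatest_nat[of "path_on P V" "[v]" f] by metis
  have longest: "length ys \<le> length xs" if "path_on P V ys" for ys
  proof (rule ccontr)
    assume "\<not> length ys \<le> length xs"
    then have "Suc (length xs) * (card V + 1) \<le> length ys * (card V + 1)" by (intro mult_le_mono1) simp
    then show False using f[OF that] deg[of "hd xs"] by (simp add: f_def)
  qed
  have maxdeg: "deg (hd ys) \<le> deg (hd xs)" if "path_on P V ys" "length ys = length xs" for ys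
    using f[OF that(1)] that(2) by (simp add: f_def)
  have ne: "xs \<noteq> []" using longest[of "[v]"] v by (auto simp: path_on_def)
  define d where "d = deg (hd xs)"
  define F where "F = set (take (k - 1) xs)"
  have nbr: "y \<in> F" if "y \<in> V" "P (hd xs) y" for y
    using neighbours_of_longest_path_start[OF \<open>symp P\<close> psubset.prems(2) p ne longest that] by (simp add: F_def)
  define J where "J = {j. j < length xs \<and> P (hd xs) (xs ! j)}"
  have "inj_on ((!) xs) J" using p by (auto simp: J_def path_on_def inj_on_def nth_eq_iff_index_eq)
  moreover have "(!) xs ` J = {y\<in>V. P (hd xs) y}"
    using p nbr set_take_subset[of "k - 1" xs]
    by (fastforce simp: J_def path_on_def F_def in_set_conv_nth)
  ultimately have cJ: "card J = d" by (metis card_image d_def deg_def)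
  have J0: "0 < j" if "j \<in> J" for j
    using that \<open>irreflp P\<close> ne by (cases j) (auto simp: J_def hd_conv_nth dest: irreflpD)
  \<comment> \<open>The predecessors on the path of the neighbours of \<open>hd xs\<close>: exactly
    the vertices that a rotation can bring to the front.\<close>
  define T where "T = (\<lambda>j. xs ! (j - 1)) ` J"
  have "inj_on (\<lambda>j. xs ! (j - 1)) J"
  proof (rule inj_onI)
    fix i j assume ij: "i \<in> J" "j \<in> J" "xs ! (i - 1) = xs ! (j - 1)"
    then have "i - 1 = j - 1" using p by (auto simp: J_def path_on_def nth_eq_iff_index_eq)
    then show "i = j" using J0 ij by (metis Suc_pred' diff_Suc_1)
  qed
  then have cT: "card T = d" by (simp add: T_def card_image cJ)
  have TV: "T \<subseteq> V" using p by (auto simp: T_def J_def path_on_def)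
  have T: "deg x \<le> d \<and> x \<in> F \<and> {y\<in>V. P x y} \<subseteq> F" if x: "x \<in> T" for x
  proof -
    obtain j where j: "j \<in> J" "x = xs ! (j - 1)" using x by (auto simp: T_def)
    let ?ys = "rev (take j xs) @ drop j xs"
    have jl: "0 < j" "j < length xs" "P (xs ! 0) (xs ! j)"
      using j J0 ne by (auto simp: J_def hd_conv_nth)
    have path: "path_on P V ?ys" by (rule path_on_rotate[OF \<open>symp P\<close> p jl])
    have len: "length ?ys = length xs" using jl by simp
    have hd: "hd ?ys = x" using jl ne j by (simp add: hd_append hd_rev last_conv_nth)
    \<comment> \<open>As \<open>j < k - 1\<close>, the rotation only permutes the first
      \<open>k - 1\<close> vertices, so all rotated paths share the same \<open>F\<close>.\<close>
    have "xs ! j \<in> V" using jl p nth_mem[of j xs] by (auto simp: path_on_def)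
    then have "xs ! j \<in> F" using nbr j by (simp add: J_def)
    then have jk: "j < k - 1"
      using p jl by (auto simp: F_def path_on_def in_set_conv_nth nth_eq_iff_index_eq)
    have "take (k - 1) ?ys = rev (take j xs) @ take (k - 1 - j) (drop j xs)" using jk jl by simp
    moreover have "take (k - 1) xs = take j xs @ take (k - 1 - j) (drop j xs)"
      using jk by (metis le_add_diff_inverse less_imp_le_nat take_add)
    ultimately have F: "set (take (k - 1) ?ys) = F" unfolding F_def by simp
    have "x \<in> F" unfolding F_def j(2) using jk jl by (auto simp: in_set_conv_nth intro!: exI[of _ "j - 1"])
    moreover have "y \<in> F" if "y \<in> V" "P x y" for y
      using neighbours_of_longest_path_start[OF \<open>symp P\<close> psubset.prems(2) path, of k y]
        longest len hd that ne F by fastforce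
    moreover have "deg x \<le> d" using maxdeg[OF path len] hd by (simp add: d_def)
    ultimately show ?thesis by auto
  qed
  let ?Z = "\<lambda>A B. {(x, y). x \<in> A \<and> y \<in> B \<and> P x y}"
  have fin: "finite (?Z A B)" if "A \<subseteq> V" "B \<subseteq> V" for A B
    using that finite_subset[of "?Z A B" "V \<times> V"] by auto
  show ?case
  proof (cases "d = 0")
    case True
    \<comment> \<open>Although \<open>d\<close> bounds only the degrees of first vertices of longest
      paths, \<open>d = 0\<close> excludes every edge: with an edge present, a longest path has a
      second vertex, adjacent to its first.\<close>
    have "\<not> P x y" if "x \<in> V" "y \<in> V" for x y
    proof
      assume xy: "P x y"
      then have "path_on P V [x, y]" using that \<open>irreflp P\<close> by (auto simp: path_on_def dest: irreflpD)
      then have "2 \<le> length xs" using longest by force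
      then have "P (hd xs) (xs ! 1)" "xs ! 1 \<in> V"
        using p ne successively_nth[of P xs 0] by (auto simp: path_on_def hd_conv_nth)
      then have "{y\<in>V. P (hd xs) y} \<noteq> {}" by auto
      then show False using True by (simp add: d_def deg_def) blast
    qed
    then have Z: "?Z V V = {}" by auto
    show ?thesis unfolding Z by simp
  next
    case False
    then have "T \<noteq> {}" using cT by auto
    then have psub: "V - T \<subset> V" using TV by auto
    have hdV: "hd xs \<in> V" using p ne by (auto simp: path_on_def)
    then have "{y\<in>V. P (hd xs) y} \<subseteq> V - {hd xs}" using \<open>irreflp P\<close> by (auto dest: irreflpD)
    then have "d \<le> card (V - {hd xs})" by (metis card_mono d_def deg_def finite_Diff psubset.hyps)
    moreover have "0 < card V" using hdV by (auto simp: card_gt_0_iff)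
    ultimately have dV: "d < card V" using hdV by simp
    have cVT: "card (V - T) = card V - d" using TV cT by (simp add: card_Diff_subset finite_subset)
    have IH: "card (?Z (V - T) (V - T)) \<le> (k - 1) * (card V - d - 1)"
    proof -
      have "V - T \<noteq> {}" using cVT dV by (metis card.empty not_less_zero zero_less_diff)
      moreover have "\<not> P (last ys) (hd ys)" if "path_on P (V - T) ys" "k \<le> length ys" for ys
        using psubset.prems(2)[of ys] that by (auto simp: path_on_def)
      ultimately show ?thesis using psubset.IH[OF psub] cVT by simp
    qed
    have finT: "finite T" using finite_subset[OF TV] by simp
    have out: "card (?Z T V) \<le> d * d"
      using card_pairs_le[of T V P d] T finT by (simp add: cT deg_def)
    have TF: "T \<subseteq> F" using T by auto
    have cF: "card F \<le> k - 1" unfolding F_def by (metis card_length length_take min.cobounded2 le_trans)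
    have dk: "d \<le> k - 1" using card_mono[OF _ TF] cF cT by (simp add: F_def)
    \<comment> \<open>By symmetry every neighbour of a vertex of \<open>T\<close> lies in
      \<open>F\<close>, so only \<open>F - T\<close> can send pairs into \<open>T\<close> from
      outside.\<close>
    have "?Z (V - T) T \<subseteq> (F - T) \<times> T" using T \<open>symp P\<close> TV by (auto dest: sympD)
    then have "card (?Z (V - T) T) \<le> card (F - T) * d"
      using card_mono[of "(F - T) \<times> T"] finT by (simp add: card_cartesian_product cT F_def)
    also have "\<dots> \<le> (k - 1 - d) * d"
      using card_Diff_subset[OF finT TF] cF cT by (intro mult_le_mono1) simp
    finally have into: "card (?Z (V - T) T) \<le> (k - 1 - d) * d" .
    have "?Z V V \<subseteq> ?Z (V - T) (V - T) \<union> ?Z T V \<union> ?Z (V - T) T" using TV by auto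
    then have "card (?Z V V) \<le> card (?Z (V - T) (V - T) \<union> ?Z T V \<union> ?Z (V - T) T)"
      using TV by (intro card_mono finite_UnI fin) blast+
    also have "\<dots> \<le> card (?Z (V - T) (V - T)) + card (?Z T V) + card (?Z (V - T) T)"
      by (meson add_le_mono1 card_Un_le le_trans)
    also have "\<dots> \<le> (k - 1) * (card V - d - 1) + (d * d + (k - 1 - d) * d)"
      using IH out into by simp
    also have "d * d + (k - 1 - d) * d = (k - 1) * d"
      using dk by (metis add_mult_distrib le_add_diff_inverse)
    also have "(k - 1) * (card V - d - 1) + (k - 1) * d = (k - 1) * (card V - 1)"
      using dV by (simp flip: add_mult_distrib2)
    finally show ?thesis .
  qed
qed

subsection \<open>Tailed triangles along cycles\<close>

text \<open>Stated with at least \<open>n\<close> vertices, so that paths can be built without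
  trimming; a prefix then yields the exact graph.\<close>

definition has_tailed_triangle :: "('a \<Rightarrow> 'a \<Rightarrow> bool) \<Rightarrow> 'a set \<Rightarrow> nat \<Rightarrow> bool" where
  "has_tailed_triangle P V n \<longleftrightarrow>
     (\<exists>xs. path_on P V xs \<and> 3 \<le> length xs \<and> n \<le> length xs \<and> P (xs ! 0) (xs ! 2))"

lemma has_tailed_triangleI:
  assumes "path_on P V (x # y # z # ws)" "P x z" "n \<le> length ws + 3"
  shows "has_tailed_triangle P V n"
  unfolding has_tailed_triangle_def using assms by (intro exI[of _ "x # y # z # ws"]) simp

text \<open>A cycle of length \<open>m\<close> is an \<open>m\<close>-periodic map from the integers.\<close>

definition is_cycle :: "('a \<Rightarrow> 'a \<Rightarrow> bool) \<Rightarrow> 'a set \<Rightarrow> int \<Rightarrow> (int \<Rightarrow> 'a) \<Rightarrow> bool" where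
  "is_cycle P V m v \<longleftrightarrow>
     (\<forall>i. v i \<in> V \<and> P (v i) (v (i + 1))) \<and> (\<forall>i j. v i = v j \<longleftrightarrow> m dvd i - j)"

lemma is_cycle_of_list:
  assumes p: "path_on P V xs" and ne: "xs \<noteq> []" and closed: "P (last xs) (hd xs)"
  shows "is_cycle P V (int (length xs)) (\<lambda>i. xs ! nat (i mod int (length xs)))"
proof -
  let ?m = "int (length xs)"
  have m: "0 < ?m" using ne by simp
  then have b: "nat (i mod ?m) < length xs" for i by (simp add: nat_less_iff)
  have "xs ! nat (i mod ?m) = xs ! nat (j mod ?m) \<longleftrightarrow> ?m dvd i - j" for i j
  proof -
    have "xs ! nat (i mod ?m) = xs ! nat (j mod ?m) \<longleftrightarrow> nat (i mod ?m) = nat (j mod ?m)"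
      using p b by (simp add: path_on_def nth_eq_iff_index_eq)
    also have "\<dots> \<longleftrightarrow> i mod ?m = j mod ?m" using m by (simp add: eq_nat_nat_iff)
    finally show ?thesis by (simp add: mod_eq_dvd_iff)
  qed
  moreover have "P (xs ! nat (i mod ?m)) (xs ! nat ((i + 1) mod ?m))" for i
  proof (cases "i mod ?m = ?m - 1")
    case True
    then have "(i + 1) mod ?m = 0" by (metis add.commute diff_add_cancel mod_add_right_eq mod_self)
    moreover have "nat (i mod ?m) = length xs - 1" using True by simp
    ultimately show ?thesis using closed ne by (simp add: last_conv_nth hd_conv_nth)
  next
    case False
    then have "i mod ?m + 1 < ?m" using pos_mod_bound[OF m, of i] by simp
    moreover have "(i + 1) mod ?m = (i mod ?m + 1) mod ?m" by (simp add: mod_add_left_eq)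
    ultimately have "(i + 1) mod ?m = i mod ?m + 1" using m by simp
    then have "nat ((i + 1) mod ?m) = Suc (nat (i mod ?m))" using m by (simp add: nat_add_distrib)
    then show ?thesis using p b[of "i + 1"] by (simp add: path_on_def successively_nth)
  qed
  moreover have "xs ! nat (i mod ?m) \<in> V" for i
    using p b[of i] by (auto simp: path_on_def)
  ultimately show ?thesis by (simp add: is_cycle_def)
qed

lemma path_on_cycle_segment:
  assumes c: "is_cycle P V m v" and "b - a < m"
  shows "path_on P V (map v [a..b])"
proof -
  have "inj_on v {a..b}"
  proof (rule inj_onI)
    fix i j assume ij: "i \<in> {a..b}" "j \<in> {a..b}" "v i = v j"
    then have "m dvd i - j" using c by (simp add: is_cycle_def)
    moreover have "\<bar>i - j\<bar> < m" using ij assms by auto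
    ultimately show "i = j" using dvd_imp_le_int[of "i - j" m] by fastforce
  qed
  then have "distinct (map v [a..b])" by (simp add: distinct_map)
  then show ?thesis
    using c by (auto simp: path_on_def is_cycle_def successively_conv_nth ac_simps)
qed

lemma card_range_cycle:
  assumes c: "is_cycle P V m v" and "0 < m"
  shows "card (range v) = nat m"
proof -
  have "inj_on v {0..<m}"
  proof (rule inj_onI)
    fix i j assume ij: "i \<in> {0..<m}" "j \<in> {0..<m}" "v i = v j"
    then have "m dvd i - j" using c by (simp add: is_cycle_def)
    moreover have "\<bar>i - j\<bar> < m" using ij by auto
    ultimately show "i = j" using dvd_imp_le_int[of "i - j" m] by fastforce
  qed
  moreover have "range v = v ` {0..<m}"
  proof -
    have "v i = v (i mod m)" for i using c by (simp add: is_cycle_def)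
    then show ?thesis using \<open>0 < m\<close> by (auto intro!: image_eqI[of _ v "_ mod m"])
  qed
  ultimately show ?thesis by (simp add: card_image)
qed

text \<open>Cutting the cycle just before \<open>v i\<close> gives a path on all \<open>m\<close>
  vertices, and the chord closes its first three to a triangle.\<close>

lemma cycle_chord:
  assumes c: "is_cycle P V m v" and "3 \<le> m" and "P (v i) (v (i + 2))" "int n \<le> m"
  shows "has_tailed_triangle P V n"
proof -
  have "[i..i + m - 1] = i # (i + 1) # (i + 2) # [i + 3..i + m - 1]"
    using \<open>3 \<le> m\<close> by (simp add: upto_rec1 ac_simps)
  then show ?thesis
    using path_on_cycle_segment[OF c, of "i + m - 1" i] assms
    by (intro has_tailed_triangleI[where ws = "map v [i + 3..i + m - 1]"]) auto
qed

text \<open>Inserting \<open>w\<close> between \<open>v i\<close> and \<open>v (i + 1)\<close> gives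
  a path on \<open>m + 1\<close> vertices; the bypassed cycle edge closes the triangle.\<close>

lemma cycle_ear:
  assumes c: "is_cycle P V m v" and "symp P" "3 \<le> m" and w: "w \<in> V" "w \<notin> range v"
    and e: "P w (v i)" "P w (v (i + 1))" and "int n \<le> m + 1"
  shows "has_tailed_triangle P V n"
proof -
  have "[i..i + m - 1] = i # (i + 1) # [i + 2..i + m - 1]"
    using \<open>3 \<le> m\<close> by (simp add: upto_rec1 ac_simps)
  then have "path_on P V (v i # w # v (i + 1) # map v [i + 2..i + m - 1])"
    using path_on_cycle_segment[OF c, of "i + m - 1" i] w e \<open>symp P\<close>
    by (auto simp: path_on_def dest: sympD)
  moreover have "P (v i) (v (i + 1))" using c by (simp add: is_cycle_def)
  ultimately show ?thesis using assms by (auto intro: has_tailed_triangleI)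
qed

text \<open>Doubling is a bijection modulo an odd number, so the two-step chords form a single
  cycle.\<close>

lemma two_step_cycle_odd:
  assumes "is_cycle P V m v" "odd m" "\<And>i. Q (v i) (v (i + 2))"
  shows "is_cycle Q V m (\<lambda>j. v (a + 2 * j))"
proof -
  have "m dvd 2 * i - 2 * j \<longleftrightarrow> m dvd i - j" for i j
    using \<open>odd m\<close> coprime_dvd_mult_right_iff[of m 2 "i - j"] by (simp add: right_diff_distrib coprime_commute)
  then show ?thesis
    using assms(1) assms(3)[of "a + 2 * i" for i] by (auto simp: is_cycle_def ac_simps)
qed

text \<open>Here the two-step chords stay within the parity class of \<open>a\<close>, which has
  half the length.\<close>

lemma two_step_cycle_even:
  assumes "is_cycle P V (2 * h) v" "\<And>i. Q (v i) (v (i + 2))"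
  shows "is_cycle Q V h (\<lambda>j. v (a + 2 * j))"
proof -
  have "2 * h dvd 2 * i - 2 * j \<longleftrightarrow> h dvd i - j" for i j :: int
    using dvd_mult_cancel_left[of 2 h "i - j"] by (simp add: right_diff_distrib)
  then show ?thesis
    using assms(1) assms(2)[of "a + 2 * i" for i] by (auto simp: is_cycle_def ac_simps)
qed

text \<open>The length condition ensures that no two entries of \<open>ws\<close> become
  adjacent.\<close>

lemma successively_splice:
  assumes "successively P xs" "symp P" "\<And>x w. x \<in> set xs \<Longrightarrow> w \<in> set ws \<Longrightarrow> P x w" "length ws \<le> length xs"
  shows "successively P (splice xs ws)"
  using assms
proof (induction xs arbitrary: ws)
  case Nil
  then show ?case by simp
next
  case (Cons x xs)
  show ?case
  proof (cases ws)
    case Nil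
    then show ?thesis using Cons.prems by simp
  next
    case [simp]: (Cons w us)
    have "successively P (splice xs us)"
      using Cons.prems by (intro Cons.IH) (auto simp: successively_Cons)
    moreover have "splice xs us = [] \<or> P w (hd (splice xs us))"
      using Cons.prems by (cases xs) (auto dest: sympD)
    moreover have "P x w" using Cons.prems by simp
    ultimately show ?thesis by (auto simp: successively_Cons)
  qed
qed

lemma last_splice: "length ws < length xs \<Longrightarrow> last (splice xs ws) = last xs"
proof (induction xs arbitrary: ws)
  case (Cons x xs)
  then show ?case by (cases ws; cases xs) auto
qed simp

text \<open>The vertices of \<open>D\<close> are interleaved with those of the cycle, and the first
  bypassed cycle edge is \<open>P x z\<close>. If \<open>D\<close> is smaller than the cycle, the
  path ends at a prescribed cycle vertex, where it can be prolonged.\<close>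

lemma splice_into_cycle:
  assumes c: "is_cycle P V h e" and "symp P" "2 \<le> h"
    and D: "finite D" "D \<subseteq> V" "D \<inter> range e = {}" "D \<noteq> {}" "int (card D) \<le> h"
    and full: "\<And>w i. w \<in> D \<Longrightarrow> P w (e i)"
  obtains x y z ws where "path_on P (range e \<union> D) (x # y # z # ws)" "P x z"
    "int (length ws) + 3 = h + int (card D)"
    "int (card D) < h \<Longrightarrow> last (z # ws) = e a"
proof -
  define es where "es = map e [a - h + 1..a]"
  have es: "path_on P V es" unfolding es_def by (rule path_on_cycle_segment[OF c]) simp
  have les: "int (length es) = h" using \<open>2 \<le> h\<close> by (simp add: es_def)
  have "[a - h + 1..a] = (a - h + 1) # (a - h + 2) # [a - h + 3..a]"
    using \<open>2 \<le> h\<close> by (simp add: upto_rec1 ac_simps)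
  then obtain x z es' where es': "es = x # z # es'" by (simp add: es_def)
  obtain ds where ds: "set ds = D" "distinct ds" using D finite_distinct_list by blast
  then have lds: "length ds = card D" by (metis distinct_card)
  then obtain y ds' where ds': "ds = y # ds'" using ds D by (cases ds) auto
  let ?p = "splice es ds"
  have sub: "set es \<subseteq> range e" by (auto simp: es_def)
  have "distinct ?p"
    using es ds D sub by (intro distinct_disjoint_shuffles[OF _ _ _ splice_in_shuffles]) (auto simp: path_on_def)
  moreover have "set ?p = set es \<union> D" using set_shuffles[OF splice_in_shuffles, of es ds] ds by simp
  moreover have "P b w" if "b \<in> set es" "w \<in> set ds" for b w
    using that full sub ds \<open>symp P\<close> by (blast dest: sympD)
  then have "successively P ?p"
    using es ds D les lds \<open>symp P\<close>
    by (intro successively_splice) (auto simp: path_on_def)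
  ultimately have "path_on P (range e \<union> D) ?p" using sub by (auto simp: path_on_def)
  moreover have p: "?p = x # y # z # splice ds' es'" by (simp add: es' ds')
  moreover have "P x z" using es by (simp add: es' path_on_def)
  moreover have "int (length (splice ds' es')) + 3 = h + int (card D)"
    using les lds by (simp add: es' ds')
  moreover have "last (z # splice ds' es') = e a" if "int (card D) < h"
  proof -
    have "last ?p = last es" using that les lds by (intro last_splice) simp
    also have "last es = e a" using \<open>2 \<le> h\<close> by (simp add: es_def last_map upto_rec2)
    finally show ?thesis by (simp add: p)
  qed
  ultimately show ?thesis using that by metis
qed

subsection \<open>Two-coloured complete graphs with a long monochromatic cycle\<close>

lemma path_on_append:
  "path_on P V (xs @ ys) \<longleftrightarrow> path_on P V xs \<and> path_on P V ys \<and> set xs \<inter> set ys = {} \<and>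
     (xs = [] \<or> ys = [] \<or> P (last xs) (hd ys))"
  by (auto simp: path_on_def successively_append_iff)

text \<open>A hypothetical counterexample. The conditions are symmetric in \<open>P\<close> and
  \<open>Q\<close>, so every consequence also holds with the colours exchanged.\<close>

locale two_cover =
  fixes P Q :: "'a \<Rightarrow> 'a \<Rightarrow> bool" and V :: "'a set" and t :: nat
  assumes finite_V: "finite V" and card_V: "card V = 2 * t - 1" and t: "5 \<le> t"
    and sym_P: "symp P" and sym_Q: "symp Q"
    and cover: "\<And>x y. \<lbrakk>x \<in> V; y \<in> V; x \<noteq> y\<rbrakk> \<Longrightarrow> P x y \<or> Q x y"
    and no_P: "\<not> has_tailed_triangle P V t" and no_Q: "\<not> has_tailed_triangle Q V t"
begin

lemma two_step:
  assumes c: "is_cycle P V m v" and m: "int t \<le> m"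
  shows "Q (v i) (v (i + 2))"
proof -
  have "v i \<noteq> v (i + 2)" using c m t zdvd_imp_le[of m 2] by (auto simp: is_cycle_def)
  moreover have "v i \<in> V" "v (i + 2) \<in> V" using c by (auto simp: is_cycle_def)
  moreover have "\<not> P (v i) (v (i + 2))" using cycle_chord[OF c _ _ m] m t no_P by force
  ultimately show ?thesis using cover by blast
qed

lemma consecutive:
  assumes c: "is_cycle P V m v" and m: "int t \<le> m" and w: "w \<in> V" "w \<notin> range v"
  shows "Q w (v i) \<or> Q w (v (i + 1))"
proof -
  have "v i \<in> V" "v (i + 1) \<in> V" using c by (auto simp: is_cycle_def)
  moreover have "\<not> (P w (v i) \<and> P w (v (i + 1)))"
    using cycle_ear[OF c sym_P _ w, of i t] m t no_P by force
  moreover have "w \<noteq> v i" "w \<noteq> v (i + 1)" using w by auto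
  ultimately show ?thesis using cover w by blast
qed

lemma ex_outside:
  assumes c: "is_cycle P V m v" and m: "int t \<le> m" "m \<le> 2 * int t - 2"
  obtains w where "w \<in> V" "w \<notin> range v"
proof -
  have "card (range v) = nat m" using card_range_cycle[OF c] m t by simp
  then have "range v \<noteq> V" using card_V m t by auto
  moreover have "range v \<subseteq> V" using c by (auto simp: is_cycle_def)
  ultimately show ?thesis using that by blast
qed

lemma no_odd_cycle:
  assumes c: "is_cycle P V m v" and m: "int t \<le> m" "m \<le> 2 * int t - 2" and odd: "odd m"
  shows False
proof -
  obtain w where w: "w \<in> V" "w \<notin> range v" using ex_outside[OF c m] .
  have "\<not> (Q w (v i) \<and> Q w (v (i + 2)))" for i
  proof -
    have c': "is_cycle Q V m (\<lambda>j. v (i + 2 * j))"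
      using two_step_cycle_odd[of P V m v Q i] c odd two_step[OF c m(1)] by blast
    have "w \<notin> range (\<lambda>j. v (i + 2 * j))" using w by auto
    from cycle_ear[OF c' sym_Q _ w(1) this, of 0 t] show ?thesis using m t no_Q by auto
  qed
  moreover have "Q w (v i) \<or> Q w (v (i + 1))" for i using consecutive[OF c m(1) w] .
  \<comment> \<open>A \<open>Q\<close>-neighbour \<open>v i\<close> would exclude
    \<open>v (i + 2)\<close>; then \<open>v (i + 1)\<close> and \<open>v (i + 3)\<close> would both
    be \<open>Q\<close>-neighbours, at distance two.\<close>
  ultimately have "\<not> Q w (v i)" for i
    by (metis add.assoc diff_add_cancel one_add_one)
  then show False using \<open>\<And>i. Q w (v i) \<or> Q w (v (i + 1))\<close> by blast
qed

end

section \<open>Even monochromatic cycles that miss a vertex\<close>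

locale even_cycle = two_cover +
  fixes h :: int and v :: "int \<Rightarrow> 'a"
  assumes c: "is_cycle P V (2 * h) v" and h: "int t \<le> 2 * h" "2 * h \<le> 2 * int t - 2"
begin

lemma h3: "3 \<le> h" using h t by simp

definition U :: "'a set" where
  "U = V - range v"

text \<open>A vertex is mixed if it has \<open>Q\<close>-neighbours in both parity classes of the cycle.\<close>

definition mixed :: "'a \<Rightarrow> bool" where
  "mixed w \<longleftrightarrow> (\<forall>i. \<exists>l. odd (l - i) \<and> Q w (v l))"

abbreviation pair :: "'a \<Rightarrow> int \<Rightarrow> bool" where
  "pair w i \<equiv> Q w (v i) \<and> Q w (v (i + 2))"

lemma class_cycle: "is_cycle Q V h (\<lambda>j. v (a + 2 * j))"
  using two_step_cycle_even[of P V h v Q a] c two_step[OF c h(1)] by blast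

lemma v_cong: "v i = v j \<longleftrightarrow> 2 * h dvd i - j"
  using c by (simp add: is_cycle_def)

lemma next_Q: "w \<in> U \<Longrightarrow> \<not> Q w (v i) \<Longrightarrow> j = i + 1 \<or> j = i - 1 \<Longrightarrow> Q w (v j)"
  using consecutive[OF c h(1), of w i] consecutive[OF c h(1), of w "i - 1"] by (auto simp: U_def)

text \<open>The two cycle neighbours of a vertex that \<open>w\<close> misses form a pair. So either
  \<open>v 1\<close> or \<open>v 3\<close> is missed, or these two are themselves a pair.\<close>

lemma ex_pair:
  assumes "w \<in> U" obtains i where "pair w i"
proof -
  have "pair w 0 \<or> pair w 1 \<or> pair w 2"
  proof (cases "Q w (v 1)")
    case True
    then show ?thesis using next_Q[OF assms, of 3 2] next_Q[OF assms, of 3 4] by auto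
  next
    case False
    then show ?thesis using next_Q[OF assms, of 1 0] next_Q[OF assms, of 1 2] by auto
  qed
  then show ?thesis using that by blast
qed

text \<open>The triangle \<open>v i, w, v (i + 2)\<close> is continued along its parity class up to \<open>u\<close>, and from
  there through the whole other class.\<close>

lemma linked:
  assumes w: "w \<in> U" "pair w i" and u: "u \<in> U" "mixed u" "u \<noteq> w" and n: "n = h - 1 \<or> n = h - 2"
  shows "\<not> Q u (v (i + 2 * n))"
proof
  assume Qu: "Q u (v (i + 2 * n))"
  obtain l where l: "odd (l - i)" "Q u (v l)" using u(2) unfolding mixed_def by blast
  \<comment> \<open>\<open>e\<close> runs through the parity class of \<open>i\<close>, and
    \<open>f\<close> through the other one, starting at a \<open>Q\<close>-neighbour of
    \<open>u\<close>.\<close>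
  define e f where "e = (\<lambda>j. v (i + 2 * j))" and "f = (\<lambda>j. v (l + 2 * j))"
  have disj: "e j \<noteq> f k" for j k
  proof
    assume "e j = f k"
    then have "2 * h dvd (i + 2 * j) - (l + 2 * k)" by (simp add: e_def f_def v_cong)
    then have "even ((i + 2 * j) - (l + 2 * k))" by (meson dvd_mult_left)
    then show False using l by auto
  qed
  have e: "path_on Q V (map e [0..n])" and f: "path_on Q V (map f [0..h - 1])"
    using n unfolding e_def f_def by (auto intro!: path_on_cycle_segment[OF class_cycle])
  have n1: "1 \<le> n" using n h3 by auto
  then have up: "[0..n] = 0 # 1 # [2..n]" by (simp add: upto_rec1)
  have out: "w \<notin> range v" "u \<notin> range v" "w \<in> V" "u \<in> V" using w u by (auto simp: U_def)
  have "Q w (e 0)" "Q w (e 1)" using w by (auto simp: e_def)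
  then have A: "path_on Q V (e 0 # w # e 1 # map e [2..n])"
    using e out sym_Q unfolding up by (auto simp: path_on_def e_def dest: sympD)
  have "[0..h - 1] = 0 # [1..h - 1]" using h3 by (simp add: upto_rec1)
  then have B: "path_on Q V (u # map f [0..h - 1])"
    using f out l by (auto simp: path_on_def f_def)
  have "last (e 0 # w # e 1 # map e [2..n]) = e n"
  proof -
    have "last (map e [0..n]) = e n" using n1 by (simp add: upto_rec2)
    then show ?thesis unfolding up by simp
  qed
  then have "Q (last (e 0 # w # e 1 # map e [2..n])) u"
    using Qu sym_Q by (auto simp: e_def dest: sympD)
  moreover have "set (e 0 # w # e 1 # map e [2..n]) \<inter> set (u # map f [0..h - 1]) = {}"
    using disj[of 0] disj[of 1] disj out u by (auto simp: e_def f_def)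
  ultimately have "path_on Q V ((e 0 # w # e 1 # map e [2..n]) @ u # map f [0..h - 1])"
    using A B path_on_append by (metis list.sel(1))
  \<comment> \<open>The path has \<open>n + h + 3\<close> vertices, which is at least
    \<open>2 * h + 1\<close> and hence more than \<open>t\<close>.\<close>
  moreover have "Q (e 0) (e 1)" using two_step[OF c h(1), of i] by (simp add: e_def)
  ultimately have "has_tailed_triangle Q V t"
    using h n n1 by (intro has_tailed_triangleI) (auto simp: nat_le_iff)
  then show False using no_Q by blast
qed

text \<open>Indices count modulo \<open>2 * h\<close>, so the two possible ends \<open>u\<close> of
  the first class in \<open>linked\<close> lie just before \<open>v i\<close>.\<close>

lemma linked':
  assumes "w \<in> U" "pair w i" "u \<in> U" "mixed u" "u \<noteq> w" "j = i - 2 \<or> j = i - 4"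
  shows "\<not> Q u (v j)"
proof -
  have "v (i + 2 * (h - 1)) = v (i - 2)" "v (i + 2 * (h - 2)) = v (i - 4)" by (simp_all add: v_cong)
  then show ?thesis using linked[OF assms(1-5), of "h - 1"] linked[OF assms(1-5), of "h - 2"] assms(6) by auto
qed

text \<open>A pair of \<open>w\<close> produces non-neighbours of \<open>u\<close>, hence pairs of \<open>u\<close>, hence non-neighbours
  and again pairs of \<open>w\<close>, so the pairs of \<open>w\<close> travel around their whole parity class.\<close>

lemma pair_step:
  assumes w: "w \<in> U" "mixed w" and u: "u \<in> U" "mixed u" "u \<noteq> w" and p: "pair w i"
    and j: "j = 6 \<or> j = 8 \<or> j = 10"
  shows "pair w (i - j)"
proof -
  have "\<not> Q u (v (i - 2))" "\<not> Q u (v (i - 4))" using linked'[OF w(1) p u] by auto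
  then have "Q u (v (i - 1))" "Q u (v (i - 3))" "Q u (v (i - 5))"
    using next_Q[OF u(1), of "i - 2" "i - 1"] next_Q[OF u(1), of "i - 4" "i - 3"]
      next_Q[OF u(1), of "i - 4" "i - 5"] by simp_all
  then have "pair u (i - 3)" "pair u (i - 5)" by auto
  then have "\<not> Q w (v (i - 5))" "\<not> Q w (v (i - 7))" "\<not> Q w (v (i - 9))"
    using linked'[OF u(1) _ w, of "i - 3"] linked'[OF u(1) _ w, of "i - 5"] u(3) by simp_all
  then have "Q w (v (i - 4))" "Q w (v (i - 6))" "Q w (v (i - 8))" "Q w (v (i - 10))"
    using next_Q[OF w(1), of "i - 5" "i - 4"] next_Q[OF w(1), of "i - 5" "i - 6"]
      next_Q[OF w(1), of "i - 7" "i - 8"] next_Q[OF w(1), of "i - 9" "i - 10"] by simp_all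
  then show ?thesis using j by auto
qed

text \<open>With two mixed vertices, the pairs of \<open>w\<close> would go round a whole parity
  class; by \<open>linked'\<close> the vertex \<open>u\<close> would have no
  \<open>Q\<close>-neighbour in that class.\<close>

lemma mixed_unique:
  assumes w: "w \<in> U" "mixed w" and u: "u \<in> U" "mixed u"
  shows "u = w"
proof (rule ccontr)
  assume ne: "u \<noteq> w"
  obtain i where p: "pair w i" using ex_pair[OF w(1)] .
  \<comment> \<open>Steps of 6, 8 and 10 from \<open>i\<close> give the first three values of
    \<open>j\<close>; further steps of 6 give all others.\<close>
  have pairs: "pair w (i - 6 - 2 * int j)" for j :: nat
  proof (induction j rule: less_induct)
    case (less j)
    consider "j = 0" | "j = 1" | "j = 2" | k where "j = k + 3" 
      by (metis add.commute le_Suc_ex less_Suc_eq less_one not_less numeral_2_eq_2 numeral_3_eq_3 One_nat_def)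
    then show ?case
    proof cases
      case 4
      then have "pair w ((i - 6 - 2 * int k) - 6)"
        using less.IH[of k] pair_step[OF w u ne, of "i - 6 - 2 * int k" 6] by linarith
      moreover have "(i - 6 - 2 * int k) - 6 = i - 6 - 2 * int j" using 4 by simp
      ultimately show ?thesis by metis
    qed (use pair_step[OF w u ne p, of 6] pair_step[OF w u ne p, of 8] pair_step[OF w u ne p, of 10] in auto)
  qed
  obtain l where l: "odd (l - (i + 1))" "Q u (v l)" using u(2) unfolding mixed_def by blast
  then have "even (i - 8 - l)" by simp
  then obtain k where k: "i - 8 - l = 2 * k" by (elim evenE)
  \<comment> \<open>The added multiple of \<open>h\<close> makes the number nonnegative and does not
    change the cycle vertex with doubled index.\<close>
  define j where "j = nat (k + h * \<bar>k\<bar>)"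
  have "1 * \<bar>k\<bar> \<le> h * \<bar>k\<bar>" using h3 by (intro mult_right_mono) auto
  then have "0 \<le> k + h * \<bar>k\<bar>" by linarith
  then have "int j = k + h * \<bar>k\<bar>" by (simp add: j_def)
  then have "i - 6 - 2 * int j - 2 - l = 2 * (- (h * \<bar>k\<bar>))" using k by linarith
  also have "\<dots> = 2 * h * (- \<bar>k\<bar>)" by simp
  finally have "v (i - 6 - 2 * int j - 2) = v l" unfolding v_cong by (metis dvd_triv_left)
  moreover have "\<not> Q u (v (i - 6 - 2 * int j - 2))"
    using linked'[OF w(1) pairs[of j] u ne] by blast
  ultimately show False using l by metis
qed

text \<open>A vertex without \<open>Q\<close>-neighbours in one class is joined to all of the other
  class, because it misses no two consecutive cycle vertices.\<close>

lemma not_mixed: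
  assumes "w \<in> U" "\<not> mixed w"
  shows "(\<forall>j. Q w (v (0 + 2 * j))) \<or> (\<forall>j. Q w (v (1 + 2 * j)))"
proof -
  obtain i where i: "\<And>l. odd (l - i) \<Longrightarrow> \<not> Q w (v l)" using assms by (auto simp: mixed_def)
  have "Q w (v l)" if "even (l - i)" for l
    using i[of "l + 1"] that next_Q[OF assms(1), of "l + 1" l] by auto
  then show ?thesis by (cases "even i") auto
qed

text \<open>At most one vertex off the cycle is mixed. By pigeonhole, at least half of the others
  are completely joined in \<open>Q\<close> to the same parity class; splicing them into its cycle,
  and appending a mixed vertex if there is one, gives \<open>t\<close> vertices.\<close>

lemma contradiction: False
proof -
  define A where "A = {w\<in>U. mixed w}"
  define H where "H = nat h"
  have H: "int H = h" "t \<le> 2 * H" "2 * H \<le> 2 * t - 2" "H \<le> t - 1" "1 \<le> t - H" using h h3 t by (auto simp: H_def)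
  have h2: "2 \<le> h" using h3 by simp
  have finU: "finite U" using finite_V by (simp add: U_def)
  have cU: "card U = 2 * t - 1 - 2 * H"
  proof -
    have sub: "range v \<subseteq> V" using c by (auto simp: is_cycle_def)
    then have "card U = card V - card (range v)"
      unfolding U_def using finite_V by (meson card_Diff_subset finite_subset)
    then show ?thesis using card_range_cycle[OF c] h3 card_V by (simp add: H_def nat_mult_distrib)
  qed
  define D where "D a = {w\<in>U. \<not> mixed w \<and> (\<forall>j. Q w (v (a + 2 * j)))}" for a :: int
  have big: "\<exists>a. s \<le> card (D a)" if "2 * s \<le> card (U - A) + 1" for s
  proof -
    have "U - A \<subseteq> D 0 \<union> D 1" using not_mixed by (auto simp: A_def D_def)
    moreover have fin: "finite (D a)" for a using finU by (simp add: D_def)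
    ultimately have "card (U - A) \<le> card (D 0) + card (D 1)"
      by (meson card_Un_le card_mono finite_UnI le_trans)
    then have "s \<le> card (D 0) \<or> s \<le> card (D 1)" using that by linarith
    then show ?thesis by blast
  qed
  have Du: "D a \<subseteq> V" "D a \<inter> range (\<lambda>j. v (b + 2 * j)) = {}" for a b by (auto simp: D_def U_def)
  show False
  proof (cases "A = {}")
    case True
    \<comment> \<open>Here \<open>card U = 2 * (t - H) - 1\<close>, so one class receives
      \<open>t - H\<close> vertices and the spliced path has \<open>H + (t - H) = t\<close>.\<close>
    have "2 * (t - H) \<le> card (U - A) + 1" using True cU H by simp
    then obtain a where "t - H \<le> card (D a)" using big by blast
    then obtain S where S: "S \<subseteq> D a" "card S = t - H" "finite S" by (meson obtain_subset_with_card_n)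
    have "S \<noteq> {}" using S H by auto
    moreover have "int (card S) \<le> h" using S H by simp
    moreover have "S \<subseteq> V" "S \<inter> range (\<lambda>j. v (a + 2 * j)) = {}" using S(1) Du(1)[of a] Du(2)[of a a] by blast+
    moreover have "Q w (v (a + 2 * j))" if "w \<in> S" for w j using that S by (auto simp: D_def)
    ultimately obtain x y z ws where p: "path_on Q (range (\<lambda>j. v (a + 2 * j)) \<union> S) (x # y # z # ws)" "Q x z"
      "int (length ws) + 3 = h + int (card S)"
      using splice_into_cycle[OF class_cycle[of a] sym_Q h2 S(3)] by (metis (no_types, lifting))
    have "path_on Q V (x # y # z # ws)"
      using p(1) \<open>S \<subseteq> V\<close> c by (auto simp: path_on_def is_cycle_def)
    then show False using has_tailed_triangleI[of Q V x y z ws t] p(2,3) S H no_Q by auto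
  next
    case False
    then obtain w where w: "w \<in> U" "mixed w" "A = {w}" using mixed_unique by (auto simp: A_def)
    have cUA: "card (U - A) = 2 * t - 2 - 2 * H" using w cU finU by simp
    show False
    proof (cases "H = t - 1")
      case True
      \<comment> \<open>Now \<open>w\<close> is the only vertex off the cycle, so nothing can be
        spliced; instead it forms an ear on a class cycle of length \<open>t - 1\<close>.\<close>
      obtain i where i: "pair w i" using ex_pair[OF w(1)] .
      have "w \<in> V" "w \<notin> range (\<lambda>j. v (i + 2 * j))" using w by (auto simp: U_def)
      from cycle_ear[OF class_cycle sym_Q h3 this, of 0 t] show False using i True H no_Q by auto
    next
      case False
      have "2 * (t - 1 - H) \<le> card (U - A) + 1" using cUA H by simp
      then obtain a where "t - 1 - H \<le> card (D a)" using big by blast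
      then obtain S where S: "S \<subseteq> D a" "card S = t - 1 - H" "finite S" by (meson obtain_subset_with_card_n)
      \<comment> \<open>The mixed vertex has a \<open>Q\<close>-neighbour in the class of
        \<open>a\<close>; the spliced path is made to end there, and \<open>w\<close> supplies the
        missing vertex.\<close>
      obtain l where l: "odd (l - (a + 1))" "Q w (v l)" using w(2) unfolding mixed_def by blast
      then have "even (l - a)" by simp
      then obtain b where "l - a = 2 * b" by (elim evenE)
      then have b: "l = a + 2 * b" by simp
      have "S \<noteq> {}" using S H False by auto
      moreover have lt: "int (card S) < h" using S H False by simp
      moreover have "S \<subseteq> V" "S \<inter> range (\<lambda>j. v (a + 2 * j)) = {}" using S(1) Du(1)[of a] Du(2)[of a a] by blast+
      moreover have "Q w (v (a + 2 * j))" if "w \<in> S" for w j using that S by (auto simp: D_def)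
      ultimately obtain x y z ws where p: "path_on Q (range (\<lambda>j. v (a + 2 * j)) \<union> S) (x # y # z # ws)" "Q x z"
        "int (length ws) + 3 = h + int (card S)" "last (z # ws) = v (a + 2 * b)"
        using splice_into_cycle[OF class_cycle[of a] sym_Q h2 S(3), where a = b]
        by (metis (no_types, lifting) less_imp_le)
      have "path_on Q V (x # y # z # ws)"
        using p(1) \<open>S \<subseteq> V\<close> c by (auto simp: path_on_def is_cycle_def)
      moreover have "w \<notin> set (x # y # z # ws)"
      proof -
        have "w \<notin> range (\<lambda>j. v (a + 2 * j)) \<union> S" using w S by (auto simp: U_def D_def)
        then show ?thesis using p(1) by (auto simp: path_on_def)
      qed
      moreover have "Q (last (x # y # z # ws)) w" using p(4) l b sym_Q by (auto dest: sympD)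
      moreover have "path_on Q V [w]" using w by (simp add: path_on_def U_def)
      ultimately have "path_on Q V ((x # y # z # ws) @ [w])" unfolding path_on_append by auto
      then have "path_on Q V (x # y # z # (ws @ [w]))" by simp
      then show False using has_tailed_triangleI[of Q V x y z "ws @ [w]" t] p(2,3) S H False no_Q by auto
    qed
  qed
qed

end

lemma (in two_cover) no_long_cycle:
  assumes c: "is_cycle P V m v" and m: "int t \<le> m"
  shows False
proof -
  have short: False if "is_cycle P V m v" "int t \<le> m" "m \<le> 2 * int t - 2" for m v
  proof (cases "even m")
    case True
    then obtain h where "m = 2 * h" by blast
    then interpret even_cycle P Q V t h v using that by unfold_locales auto
    show False by (rule contradiction)
  next
    case False
    then show False using no_odd_cycle that by blast
  qed
  show False
  proof (cases "m \<le> 2 * int t - 2")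
    case True
    then show False using short c m by blast
  next
    case False
    have "range v \<subseteq> V" using c by (auto simp: is_cycle_def)
    then have "card (range v) \<le> 2 * t - 1" using card_V finite_V card_mono by metis
    then have "nat m \<le> 2 * t - 1" using card_range_cycle[OF c] m t by simp
    then have "m \<le> int (2 * t - 1)" by (simp only: nat_le_iff)
    then have mt: "m = 2 * int t - 1" using False t by (simp add: of_nat_diff)
    \<comment> \<open>The cycle is now spanning. The edge \<open>v 0, v 4\<close> is a two-step
      chord of the \<open>Q\<close>-cycle, hence lies in \<open>P\<close>, and closes the segment
      from \<open>v 4\<close> to \<open>v m = v 0\<close> to a \<open>P\<close>-cycle of even length
      \<open>2 * t - 4\<close>, which \<open>short\<close> excludes.\<close>
    have "path_on P V (map v [4..m])" using path_on_cycle_segment[OF c, of m 4] by simp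
    have c2: "is_cycle Q V m (\<lambda>j. v (0 + 2 * j))"
      using two_step_cycle_odd[of P V m v Q 0] c mt two_step[OF c m] by auto
    have "\<not> Q (v 0) (v 4)" using cycle_chord[OF c2, of 0 t] m t no_Q by auto
    moreover have "v 0 \<noteq> v 4" using c m t zdvd_imp_le[of m 4] by (auto simp: is_cycle_def)
    moreover have "v 0 \<in> V" "v 4 \<in> V" using c by (auto simp: is_cycle_def)
    ultimately have "P (v 0) (v 4)" using cover by blast
    moreover have "v m = v 0" using c by (simp add: is_cycle_def)
    moreover have "[4..m] = 4 # [5..m]" using m t mt by (simp add: upto_rec1)
    moreover have "last (map v [4..m]) = v m" using mt t by (simp add: upto_rec2)
    ultimately have "P (last (map v [4..m])) (hd (map v [4..m]))" by simp
    then have "is_cycle P V (int (length (map v [4..m]))) (\<lambda>i. map v [4..m] ! nat (i mod int (length (map v [4..m]))))"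
      using \<open>path_on P V (map v [4..m])\<close> \<open>[4..m] = 4 # [5..m]\<close> by (intro is_cycle_of_list) auto
    moreover have "int (length (map v [4..m])) = 2 * int t - 4" using mt t by simp
    ultimately show False using short t by force
  qed
qed

subsection \<open>The Ramsey number\<close>

lemma ex_long_cycle:
  assumes "finite V" "V \<noteq> {}" "symp P" "irreflp P"
    and "(k - 1) * (card V - 1) < card {(x, y). x \<in> V \<and> y \<in> V \<and> P x y}" and "0 < k"
  obtains m v where "is_cycle P V m v" "int k \<le> m"
proof -
  obtain xs where xs: "path_on P V xs" "k \<le> length xs" "P (last xs) (hd xs)"
    using erdos_gallai_cycle[OF assms(1-4), of k] assms(5) by force
  then have "xs \<noteq> []" using \<open>0 < k\<close> by auto
  then show ?thesis using is_cycle_of_list[OF xs(1) _ xs(3)] that xs(2) by simp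
qed

text \<open>Without a long cycle each colour has at most \<open>(t - 1) * (card V - 1)\<close>
  ordered pairs, too few to cover all \<open>card V * (card V - 1)\<close> of them, as
  \<open>card V > 2 * (t - 1)\<close>.\<close>

lemma two_cover_impossible:
  assumes "two_cover P Q V t" "irreflp P" "irreflp Q"
  shows False
proof -
  interpret PQ: two_cover P Q V t by fact
  have "two_cover Q P V t"
    using PQ.finite_V PQ.card_V PQ.t PQ.sym_P PQ.sym_Q PQ.cover PQ.no_P PQ.no_Q
    by unfold_locales blast+
  then interpret QP: two_cover Q P V t .
  let ?Z = "\<lambda>R. {(x, y). x \<in> V \<and> y \<in> V \<and> R x y}"
  have ne: "V \<noteq> {}" using PQ.card_V PQ.t by auto
  have t0: "0 < t" using PQ.t by simp
  have "card (?Z P) \<le> (t - 1) * (card V - 1)"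
  proof (rule ccontr)
    assume "\<not> ?thesis"
    then have "(t - 1) * (card V - 1) < card (?Z P)" by (simp only: not_le)
    from ex_long_cycle[OF PQ.finite_V ne PQ.sym_P assms(2) this t0] obtain m v
      where "is_cycle P V m v" "int t \<le> m" .
    then show False by (rule PQ.no_long_cycle)
  qed
  moreover have "card (?Z Q) \<le> (t - 1) * (card V - 1)"
  proof (rule ccontr)
    assume "\<not> ?thesis"
    then have "(t - 1) * (card V - 1) < card (?Z Q)" by (simp only: not_le)
    from ex_long_cycle[OF PQ.finite_V ne PQ.sym_Q assms(3) this t0] obtain m v
      where "is_cycle Q V m v" "int t \<le> m" .
    then show False by (rule QP.no_long_cycle)
  qed
  moreover have "card (\<Union>x\<in>V. {x} \<times> (V - {x})) \<le> card (?Z P) + card (?Z Q)"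
  proof -
    have "(\<Union>x\<in>V. {x} \<times> (V - {x})) \<subseteq> ?Z P \<union> ?Z Q" using PQ.cover by auto
    moreover have "finite (?Z R)" for R
      using PQ.finite_V finite_subset[of "?Z R" "V \<times> V"] by auto
    ultimately show ?thesis by (meson card_Un_le card_mono finite_UnI le_trans)
  qed
  moreover have "card (\<Union>x\<in>V. {x} \<times> (V - {x})) = card V * (card V - 1)"
    using PQ.finite_V by (subst card_UN_disjoint) (auto simp: card_cartesian_product)
  ultimately have "card V * (card V - 1) \<le> (t - 1) * (card V - 1) + (t - 1) * (card V - 1)" by linarith
  then have "card V * (card V - 1) \<le> 2 * (t - 1) * (card V - 1)" by (simp only: mult_2 add_mult_distrib)
  moreover have "2 * (t - 1) < card V" "0 < card V - 1" using PQ.card_V PQ.t by auto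
  ultimately show False by (metis mult_le_cancel2 not_le)
qed

section \<open>The case \<open>t = 4\<close>\<close>

lemma no_monochromatic_triangle:
  assumes "card V = 7" "symp P" "symp Q"
    and cover: "\<And>x y. \<lbrakk>x \<in> V; y \<in> V; x \<noteq> y\<rbrakk> \<Longrightarrow> P x y \<or> Q x y"
    and no_P: "\<not> has_tailed_triangle P V 4" and no_Q: "\<not> has_tailed_triangle Q V 4"
    and abc: "distinct [a, b, c]" "{a, b, c} \<subseteq> V" "P a b" "P b c" "P a c"
  shows False
proof -
  define D where "D = V - {a, b, c}"
  have fin: "finite V" using assms(1) by (metis card.infinite zero_neq_numeral)
  have "card D = 4" using abc assms(1) fin by (simp add: D_def card_Diff_subset)
  then obtain ds where ds: "set ds = D" "distinct ds" "length ds = 4"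
    using fin by (metis D_def distinct_card finite_Diff finite_distinct_list)
  \<comment> \<open>A \<open>P\<close>-edge leaving the triangle would be its tail.\<close>
  have Q: "Q d a" "Q d b" if "d \<in> D" for d
  proof -
    have "\<not> P a d"
      using has_tailed_triangleI[of P V b c a "[d]" 4] abc that no_P \<open>symp P\<close>
      by (auto simp: path_on_def D_def dest: sympD)
    moreover have "\<not> P b d"
      using has_tailed_triangleI[of P V a c b "[d]" 4] abc that no_P \<open>symp P\<close>
      by (auto simp: path_on_def D_def dest: sympD)
    ultimately show "Q d a" "Q d b" using cover[of a d] cover[of b d] abc that \<open>symp Q\<close>
      by (auto simp: D_def dest: sympD)
  qed
  \<comment> \<open>A \<open>Q\<close>-edge \<open>d e\<close> would form the
    \<open>Q\<close>-triangle \<open>d, a, e\<close> with tail \<open>b\<close>. Thus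
    \<open>D\<close> is a \<open>P\<close>-clique of order four, which contains a tailed
    triangle.\<close>
  have P: "P d e" if "d \<in> D" "e \<in> D" "d \<noteq> e" for d e
  proof (rule ccontr)
    assume "\<not> P d e"
    then have "Q d e" using cover that by (auto simp: D_def)
    then show False
      using has_tailed_triangleI[of Q V d a e "[b]" 4] abc that no_Q Q \<open>symp Q\<close>
      by (auto simp: path_on_def D_def dest: sympD)
  qed
  have P_nth: "P (ds ! i) (ds ! j)" if "i < 4" "j < 4" "i \<noteq> j" for i j
    using that ds nth_mem[of i ds] nth_mem[of j ds] by (intro P) (auto simp: nth_eq_iff_index_eq)
  have "set ds \<subseteq> V" using ds by (auto simp: D_def)
  then have "path_on P V ds"
    using ds(2,3) P_nth by (simp add: path_on_def successively_conv_nth)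
  moreover have "P (ds ! 0) (ds ! 2)" by (rule P_nth) auto
  ultimately have "has_tailed_triangle P V 4" using ds by (auto simp: has_tailed_triangle_def)
  then show False using no_P by blast
qed

text \<open>The classical argument for \<open>R(3, 3) \<le> 6\<close> provides a monochromatic
  triangle among the seven vertices.\<close>

lemma ex_tailed_triangle_4:
  assumes "card V = 7" "symp P" "symp Q"
    and cover: "\<And>x y. \<lbrakk>x \<in> V; y \<in> V; x \<noteq> y\<rbrakk> \<Longrightarrow> P x y \<or> Q x y"
  shows "has_tailed_triangle P V 4 \<or> has_tailed_triangle Q V 4"
proof (rule ccontr)
  assume "\<not> ?thesis"
  then have no: "\<not> has_tailed_triangle P V 4" "\<not> has_tailed_triangle Q V 4" by auto
  have cover': "\<And>x y. \<lbrakk>x \<in> V; y \<in> V; x \<noteq> y\<rbrakk> \<Longrightarrow> Q x y \<or> P x y" using cover by blast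
  note noP = no_monochromatic_triangle[OF assms(1-3) cover no]
  note noQ = no_monochromatic_triangle[OF assms(1,3,2) cover' no(2,1)]
  have fin: "finite V" using assms(1) by (metis card.infinite zero_neq_numeral)
  obtain x where x: "x \<in> V" using assms(1) by fastforce
  define A B where "A = {y \<in> V - {x}. P x y}" and "B = {y \<in> V - {x}. Q x y}"
  have "card (V - {x}) \<le> card (A \<union> B)"
    using cover x fin by (intro card_mono) (auto simp: A_def B_def)
  then have "6 \<le> card A + card B" using card_Un_le[of A B] assms(1) fin x by simp
  then consider "3 \<le> card A" | "3 \<le> card B" by linarith
  then show False
  proof cases
    case 1
    then obtain S where S: "S \<subseteq> A" "card S = 3" by (meson obtain_subset_with_card_n)
    then obtain a b c where abc: "S = {a, b, c}" "a \<noteq> b" "b \<noteq> c" "a \<noteq> c" by (auto simp: card_3_iff)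
    have V: "a \<in> V" "b \<in> V" "c \<in> V" "P x a" "P x b" "P x c" "a \<noteq> x" "b \<noteq> x" "c \<noteq> x"
      using S abc by (auto simp: A_def)
    then have "\<not> P a b" "\<not> P b c" "\<not> P a c"
      using noP[of x a b] noP[of x b c] noP[of x a c] x abc by auto
    then show False using noQ[of a b c] cover V abc by auto
  next
    case 2
    then obtain S where S: "S \<subseteq> B" "card S = 3" by (meson obtain_subset_with_card_n)
    then obtain a b c where abc: "S = {a, b, c}" "a \<noteq> b" "b \<noteq> c" "a \<noteq> c" by (auto simp: card_3_iff)
    have V: "a \<in> V" "b \<in> V" "c \<in> V" "Q x a" "Q x b" "Q x c" "a \<noteq> x" "b \<noteq> x" "c \<noteq> x"
      using S abc by (auto simp: B_def)
    then have "\<not> Q a b" "\<not> Q b c" "\<not> Q a c"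
      using noQ[of x a b] noQ[of x b c] noQ[of x a c] x abc by auto
    then show False using noP[of a b c] cover V abc by auto
  qed
qed

lemma ex_tailed_triangle:
  assumes "4 \<le> t" "card V = 2 * t - 1" "symp P" "symp Q" "irreflp P" "irreflp Q"
    and cover: "\<And>x y. \<lbrakk>x \<in> V; y \<in> V; x \<noteq> y\<rbrakk> \<Longrightarrow> P x y \<or> Q x y"
  shows "has_tailed_triangle P V t \<or> has_tailed_triangle Q V t"
proof (cases "t = 4")
  case True
  then show ?thesis using ex_tailed_triangle_4[of V P Q] assms by simp
next
  case False
  have "finite V" using assms(1,2) card.infinite by fastforce
  show ?thesis
  proof (rule ccontr)
    assume "\<not> ?thesis"
    then have "two_cover P Q V t" using assms False \<open>finite V\<close> by unfold_locales auto
    then show False using two_cover_impossible assms by blast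
  qed
qed

section \<open>Transfer to edge colourings and the upper bound\<close>

definition colour_adj :: "(nat set \<Rightarrow> colour) \<Rightarrow> colour \<Rightarrow> nat \<Rightarrow> nat \<Rightarrow> bool" where
  "colour_adj c a x y \<longleftrightarrow> x \<noteq> y \<and> c {x, y} = a"

lemma contains_copy_path_plus:
  assumes "4 \<le> t" "has_tailed_triangle (colour_adj c a) {..<n} t"
  shows "contains_copy (colour_graph n c a) (path_plus t)"
proof -
  obtain xs where p: "path_on (colour_adj c a) {..<n} xs" and len: "t \<le> length xs"
    and tri: "colour_adj c a (xs ! 0) (xs ! 2)"
    using assms(2) by (auto simp: has_tailed_triangle_def)
  have V: "xs ! i < n" if "i < length xs" for i using p that nth_mem by (fastforce simp: path_on_def)
  have V0: "xs ! 0 < n" using V[of 0] len assms(1) by linarith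
  have adj: "colour_adj c a (xs ! i) (xs ! Suc i)" if "Suc i < length xs" for i
    using p that by (simp add: path_on_def successively_nth)
  \<comment> \<open>Path vertices are numbered from 1, list positions from 0.\<close>
  define \<phi> where "\<phi> i = xs ! (i - 1)" for i
  have "inj_on \<phi> {1..t}"
    using p len by (auto simp: inj_on_def \<phi>_def path_on_def nth_eq_iff_index_eq)
  moreover have "\<phi> ` {1..t} \<subseteq> {..<n}" using V len by (auto simp: \<phi>_def)
  moreover have "\<phi> ` {1, 3} \<in> edges (colour_graph n c a)"
    using tri V0 V[of 2] len assms(1)
    by (auto simp: \<phi>_def colour_graph_def complete_graph_def edges_def colour_adj_def)
  moreover have "\<phi> ` {i, i + 1} \<in> edges (colour_graph n c a)" if "1 \<le> i" "i < t" for i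
    using adj[of "i - 1"] V[of "i - 1"] V[of i] len that
    by (auto simp: \<phi>_def colour_graph_def complete_graph_def edges_def colour_adj_def)
  ultimately show ?thesis unfolding contains_copy_def
    by (intro exI[of _ \<phi>])
      (auto simp: path_plus_def path_graph_def colour_graph_def complete_graph_def verts_def edges_def)
qed

lemma arrows_path_plus:
  assumes "4 \<le> t"
  shows "ramsey_arrows (2 * t - 1) (path_plus t) (path_plus t)"
  unfolding ramsey_arrows_def
proof
  fix c
  let ?V = "{..<2 * t - 1}"
  \<comment> \<open>Irreflexivity comes from the conjunct \<open>x \<noteq> y\<close> of
    \<open>colour_adj\<close>, since \<open>c\<close> also colours singletons.\<close>
  have "symp (colour_adj c a)" "irreflp (colour_adj c a)" for a
    by (auto simp: symp_def irreflp_def colour_adj_def insert_commute)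
  moreover have "colour_adj c Red x y \<or> colour_adj c Blue x y" if "x \<noteq> y" for x y
    using that colour.exhaust by (auto simp: colour_adj_def)
  ultimately have "has_tailed_triangle (colour_adj c Red) ?V t \<or> has_tailed_triangle (colour_adj c Blue) ?V t"
    using assms by (intro ex_tailed_triangle) auto
  then show "contains_copy (colour_graph (2 * t - 1) c Red) (path_plus t) \<or>
      contains_copy (colour_graph (2 * t - 1) c Blue) (path_plus t)"
    using contains_copy_path_plus assms by blast
qed

section \<open>The lower bound\<close>

lemma not_arrows_path_plus:
  assumes "4 \<le> t" "n \<le> 2 * t - 2"
  shows "\<not> ramsey_arrows n (path_plus t) (path_plus t)"
proof -
  define side :: "nat \<Rightarrow> bool" where "side x \<longleftrightarrow> x < t - 1" for x
  \<comment> \<open>Each side has at most \<open>t - 1\<close> vertices. Red edges stay on one side,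
    so a connected red graph on \<open>t\<close> vertices does not fit; blue edges cross, so there
    is no blue triangle.\<close>
  define c where "c e = (if \<exists>s. \<forall>x\<in>e. side x = s then Red else Blue)" for e
  have edge: "c {\<phi> i, \<phi> (i + 1)} = a" if "\<forall>e\<in>edges (path_plus t). \<phi> ` e \<in> edges (colour_graph n c a)"
    "1 \<le> i" "i < t" for \<phi> i a
  proof -
    have "{i, i + 1} \<in> edges (path_plus t)"
      using that by (auto simp: path_plus_def path_graph_def edges_def)
    then have "\<phi> ` {i, i + 1} \<in> edges (colour_graph n c a)" using that(1) by blast
    then show ?thesis by (simp add: colour_graph_def edges_def)
  qed
  have "\<not> contains_copy (colour_graph n c Red) (path_plus t)"
  proof
    assume "contains_copy (colour_graph n c Red) (path_plus t)"
    then obtain \<phi> where inj: "inj_on \<phi> {1..t}" and im: "\<phi> ` {1..t} \<subseteq> {..<n}"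
      and e: "\<forall>e\<in>edges (path_plus t). \<phi> ` e \<in> edges (colour_graph n c Red)"
      unfolding contains_copy_def
      by (auto simp: path_plus_def path_graph_def colour_graph_def complete_graph_def verts_def)
    have "side (\<phi> (Suc i)) = side (\<phi> 1)" if "i < t" for i
      using that
    proof (induction i)
      case (Suc i)
      then have "c {\<phi> (Suc i), \<phi> (Suc i + 1)} = Red" using edge[OF e] by simp
      then show ?case using Suc by (auto simp: c_def split: if_splits)
    qed simp
    then have s: "side (\<phi> i) = side (\<phi> 1)" if "i \<in> {1..t}" for i
      using that by (metis Suc_le_lessD Suc_pred' atLeastAtMost_iff One_nat_def less_le_trans zero_less_one)
    have "card (\<phi> ` {1..t}) = t" using inj by (simp add: card_image)
    moreover have "\<phi> ` {1..t} \<subseteq> {..<t - 1} \<or> \<phi> ` {1..t} \<subseteq> {t - 1..<n}"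
    proof (cases "side (\<phi> 1)")
      case True
      then show ?thesis using s by (auto simp: side_def)
    next
      case False
      have "\<phi> i \<in> {t - 1..<n}" if "i \<in> {1..t}" for i
        using s[OF that] False image_subset_iff[THEN iffD1, OF im, rule_format, OF that]
        by (simp add: side_def)
      then show ?thesis by blast
    qed
    then have "card (\<phi> ` {1..t}) \<le> t - 1"
      using card_mono[of "{..<t - 1}" "\<phi> ` {1..t}"] card_mono[of "{t - 1..<n}" "\<phi> ` {1..t}"] assms by auto
    ultimately show False using assms by simp
  qed
  moreover have "\<not> contains_copy (colour_graph n c Blue) (path_plus t)"
  proof
    assume "contains_copy (colour_graph n c Blue) (path_plus t)"
    then obtain \<phi> where e: "\<forall>e\<in>edges (path_plus t). \<phi> ` e \<in> edges (colour_graph n c Blue)"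
      unfolding contains_copy_def by blast
    have "c {\<phi> 1, \<phi> 2} = Blue" "c {\<phi> 2, \<phi> 3} = Blue" 
      using edge[OF e, of 1] edge[OF e, of 2] assms by (simp_all add: numeral_2_eq_2 numeral_3_eq_3)
    moreover have "\<phi> ` {1, 3} \<in> edges (colour_graph n c Blue)"
      using e by (simp add: path_plus_def edges_def)
    then have "c {\<phi> 1, \<phi> 3} = Blue" by (simp add: colour_graph_def edges_def)
    ultimately show False by (auto simp: c_def split: if_splits)
  qed
  ultimately show ?thesis unfolding ramsey_arrows_def by blast
qed

theorem theorem9:
  fixes t :: nat
  assumes "t \<ge> 4"
  shows "ramsey_number (path_plus t) (path_plus t) = 2 * t - 1"
  unfolding ramsey_number_def
proof (rule Least_equality)
  show "ramsey_arrows (2 * t - 1) (path_plus t) (path_plus t)" using arrows_path_plus assms .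
  show "2 * t - 1 \<le> n" if "ramsey_arrows n (path_plus t) (path_plus t)" for n
    using not_arrows_path_plus[OF assms, of n] that by fastforce
qed

end
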